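(* Let $k$ be a positive integer and let $h \geq 2$ be an integer. Put $m = 2^{\lfloor \log_2 h \rfloor + 1}k + 1$ and $n = \binom{m}{h}$. Then \[\nu^\wedge(\mathbb{Z}_n, m, h) < \min\left\{n, \binom{m}{h}\right\}\quad\text{and}\quad \nu^\wedge(\mathbb{Z}_n, m, m-h) < \min\left\{n, \binom{m}{m-h}\right\}.\]
   Context: $\mathbb{Z}_n$ denotes the additive cyclic group of order $n$, and $\lfloor x \rfloor$ is the greatest integer $\le x$. For a finite subset $A = \{a_1,\dots,a_m\}$ (with $m$ distinct elements) of an additive abelian group $G$ and an integer $h \ge 0$, the restricted $h$-fold sumset is $h^\wedge A = \{\sum_{i=1}^m \lambda_i a_i : \lambda_i \in \{0,1\},\ \sum_{i=1}^m \lambda_i = h\}$, i.e. the set of sums of $h$ distinct elements of $A$. For positive integers $m,h$, $\nu^\wedge(G,m,h) = \max\{|h^\wedge A| : A \subseteq G,\ |A| = m\}$. *)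

theory Defs
  imports Complex_Main "HOL-Algebra.FiniteProduct" "HOL-Algebra.Elementary_Groups"
begin

text \<open>Abelian groups are HOL-Algebra groups, which are written multiplicatively: the group
  operation is \<open>\<otimes>\<close>, finite sums are \<open>finprod\<close> and integer multiples are \<open>[^]\<close>.  The cyclic
  group of order \<open>n \<ge> 1\<close> is \<open>integer_mod_group n\<close>, that is, \<open>{0..<n}\<close> with addition modulo
  \<open>n\<close>.\<close>

definition restricted_sumset :: "('a, 'b) monoid_scheme \<Rightarrow> nat \<Rightarrow> 'a set \<Rightarrow> 'a set" where
  "restricted_sumset G h A =
     {finprod G (\<lambda>a. a [^]\<^bsub>G\<^esub> c a) A | c :: 'a \<Rightarrow> nat.
        (\<forall>a\<in>A. c a \<in> {0, 1}) \<and> (\<Sum>a\<in>A. c a) = h}"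

text \<open>The set under \<open>Max\<close> is finite, since all its members are at most \<open>m choose h\<close>; it is
  nonempty exactly when \<open>G\<close> has a subset with \<open>m\<close> elements, and otherwise the value is
  unspecified.\<close>

definition nu_restricted :: "('a, 'b) monoid_scheme \<Rightarrow> nat \<Rightarrow> nat \<Rightarrow> nat" where
  "nu_restricted G m h =
     Max {card (restricted_sumset G h A) | A. A \<subseteq> carrier G \<and> finite A \<and> card A = m}"

lemma restricted_sumset_eq_subset_sums:
  assumes "comm_group G" "finite A" "A \<subseteq> carrier G"
  shows "restricted_sumset G h A = {finprod G (\<lambda>a. a) S | S. S \<subseteq> A \<and> card S = h}"
proof -
  interpret comm_group G by fact
  have key: "finprod G (\<lambda>a. a [^]\<^bsub>G\<^esub> c a) A = finprod G (\<lambda>a. a) {a\<in>A. c a = 1}"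
       "(\<Sum>a\<in>A. c a) = card {a\<in>A. c a = 1}"
    if c: "\<forall>a\<in>A. c a \<in> {0, 1}" for c :: "'a \<Rightarrow> nat"
  proof -
    have "finprod G (\<lambda>a. a [^]\<^bsub>G\<^esub> c a) {a\<in>A. c a = 1} = finprod G (\<lambda>a. a [^]\<^bsub>G\<^esub> c a) A"
      using assms(2,3) c by (intro finprod_mono_neutral_cong_left) auto
    moreover have "finprod G (\<lambda>a. a [^]\<^bsub>G\<^esub> c a) {a\<in>A. c a = 1} = finprod G (\<lambda>a. a) {a\<in>A. c a = 1}"
      using assms(3) by (intro finprod_cong') auto
    ultimately show "finprod G (\<lambda>a. a [^]\<^bsub>G\<^esub> c a) A = finprod G (\<lambda>a. a) {a\<in>A. c a = 1}"
      by simp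
    have "(\<Sum>a\<in>A. c a) = (\<Sum>a\<in>A. if c a = 1 then 1 else 0)"
      using c by (intro sum.cong) auto
    also have "\<dots> = card {a\<in>A. c a = 1}"
      using assms(2) by (simp add: sum.If_cases Int_def)
    finally show "(\<Sum>a\<in>A. c a) = card {a\<in>A. c a = 1}" .
  qed
  show ?thesis
  proof (intro equalityI subsetI)
    fix x assume "x \<in> restricted_sumset G h A"
    then obtain c :: "'a \<Rightarrow> nat" where c: "\<forall>a\<in>A. c a \<in> {0, 1}" "(\<Sum>a\<in>A. c a) = h"
      and x: "x = finprod G (\<lambda>a. a [^]\<^bsub>G\<^esub> c a) A"
      unfolding restricted_sumset_def by blast
    have "x = finprod G (\<lambda>a. a) {a\<in>A. c a = 1}" "card {a\<in>A. c a = 1} = h"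
      using key[OF c(1)] c(2) x by simp_all
    then show "x \<in> {finprod G (\<lambda>a. a) S | S. S \<subseteq> A \<and> card S = h}" by blast
  next
    fix x assume "x \<in> {finprod G (\<lambda>a. a) S | S. S \<subseteq> A \<and> card S = h}"
    then obtain S where S: "S \<subseteq> A" "card S = h" and x: "x = finprod G (\<lambda>a. a) S"
      by blast
    define c :: "'a \<Rightarrow> nat" where "c = (\<lambda>a. if a \<in> S then 1 else 0)"
    have c: "\<forall>a\<in>A. c a \<in> {0, 1}" and "{a\<in>A. c a = 1} = S"
      using S(1) by (auto simp: c_def)
    then have "x = finprod G (\<lambda>a. a [^]\<^bsub>G\<^esub> c a) A" "(\<Sum>a\<in>A. c a) = h"
      using key[OF c] S(2) x by simp_all
    with c show "x \<in> restricted_sumset G h A"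
      unfolding restricted_sumset_def by blast
  qed
qed

end

theory Submission
  imports Defs
begin

text \<open>If the restricted sumset had \<open>n = m choose h\<close> elements, the sums of the \<open>h\<close>-subsets of \<open>A\<close>
  would be the \<open>n\<close> residues, each exactly once, with total \<open>n (n - 1) / 2\<close>. Modulo \<open>n\<close> the total
  is also \<open>((m - 1) choose (h - 1)) * \<Sum>A\<close>, which is killed by \<open>m\<close> because
  \<open>m * ((m - 1) choose (h - 1)) = h * n\<close>. Hence \<open>m (n - 1)\<close> is even. For the given \<open>m\<close> this is
  false: \<open>m\<close> is odd and \<open>m choose h\<close> is even. The same argument applies to \<open>m - h\<close>.\<close>

text \<open>In \<open>i * (M choose i) = M * ((M - 1) choose (i - 1))\<close> the right side is
  divisible by \<open>2 ^ s\<close>. An odd binomial coefficient would push the whole power onto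
  \<open>i\<close>, which is positive and too small for that.\<close>

lemma even_choose_of_pow2_dvd:
  fixes i M s :: nat
  assumes "2 ^ s dvd M" "0 < i" "i < 2 ^ s"
  shows "even (M choose i)"
proof (rule ccontr)
  assume "odd (M choose i)"
  then have cop: "coprime (2 ^ s) (M choose i)" by simp
  have "i * (M choose i) = M * ((M - 1) choose (i - 1))"
    using times_binomial_minus1_eq[OF assms(2), of M] .
  then have "2 ^ s dvd i * (M choose i)" using assms(1) by simp
  then have "2 ^ s dvd i" using cop by (simp add: coprime_dvd_mult_left_iff)
  then show False using assms(2,3) by (auto dest: dvd_imp_le)
qed

text \<open>Guarantees that the cyclic group of order \<open>m choose h\<close> has a subset with
  \<open>m\<close> elements, so that the maximum defining \<open>nu_restricted\<close> is over a
  nonempty set.\<close>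

lemma le_choose:
  fixes m h :: nat
  assumes "0 < h" "h < m"
  shows "m \<le> m choose h"
  using assms
proof (induction m arbitrary: h)
  case (Suc m)
  then obtain j where j: "h = Suc j" by (cases h) auto
  show ?case
  proof (cases "h = m")
    case False
    then have "m \<le> m choose h" using Suc by simp
    moreover have "0 < m choose j" using Suc.prems j by (simp add: zero_less_binomial_iff)
    ultimately show ?thesis unfolding j binomial_Suc_Suc by linarith
  qed (simp add: binomial_Suc_n)
qed simp

text \<open>Double counting: each \<open>a\<close> in \<open>A\<close> lies in as many
  \<open>h\<close>-subsets as there are ways to choose the other \<open>h - 1\<close> members from
  \<open>A - {a}\<close>.\<close>

lemma sum_subset_sums:
  fixes A :: "int set"
  assumes "finite A" "0 < h"
  shows "(\<Sum>S | S \<subseteq> A \<and> card S = h. \<Sum>S) = int ((card A - 1) choose (h - 1)) * \<Sum>A"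
proof -
  let ?\<S> = "{S. S \<subseteq> A \<and> card S = h}"
  have fin: "finite ?\<S>" using assms(1) by simp
  have card_containing: "card {S \<in> ?\<S>. a \<in> S} = (card A - 1) choose (h - 1)" if "a \<in> A" for a
  proof -
    let ?\<T> = "{T. T \<subseteq> A - {a} \<and> card T = h - 1}"
    have "bij_betw (insert a) ?\<T> {S \<in> ?\<S>. a \<in> S}"
    proof (rule bij_betw_byWitness[where f' = "\<lambda>S. S - {a}"])
      show "insert a ` ?\<T> \<subseteq> {S \<in> ?\<S>. a \<in> S}"
      proof
        fix S assume "S \<in> insert a ` ?\<T>"
        then obtain T where T: "S = insert a T" "T \<subseteq> A - {a}" "card T = h - 1" by auto
        then have "finite T" "a \<notin> T" using assms(1) finite_subset by auto
        then show "S \<in> {S \<in> ?\<S>. a \<in> S}" using T that assms(2) by auto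
      qed
      show "(\<lambda>S. S - {a}) ` {S \<in> ?\<S>. a \<in> S} \<subseteq> ?\<T>"
        using assms(1) by auto
    qed auto
    then have "card {S \<in> ?\<S>. a \<in> S} = card ?\<T>" by (simp add: bij_betw_same_card)
    also have "\<dots> = (card A - 1) choose (h - 1)"
      using assms(1) that by (simp add: n_subsets)
    finally show ?thesis .
  qed
  have "(\<Sum>S\<in>?\<S>. \<Sum>S) = (\<Sum>S\<in>?\<S>. \<Sum>a\<in>A. if a \<in> S then a else 0)"
    using assms(1) by (intro sum.cong[OF refl]) (simp add: Int_absorb1 flip: sum.inter_restrict)
  also have "\<dots> = (\<Sum>a\<in>A. \<Sum>S\<in>?\<S>. if a \<in> S then a else 0)"
    by (rule sum.swap)
  also have "\<dots> = (\<Sum>a\<in>A. int (card {S \<in> ?\<S>. a \<in> S}) * a)"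
    using fin by (intro sum.cong) (simp_all flip: sum.inter_filter)
  also have "\<dots> = (\<Sum>a\<in>A. int ((card A - 1) choose (h - 1)) * a)"
    by (intro sum.cong) (simp_all only: card_containing)
  finally show ?thesis by (simp add: sum_distrib_left)
qed

text \<open>Moves group sums into the integers with a single final reduction, where the double
  counting takes place.\<close>

lemma finprod_integer_mod_group:
  fixes f :: "'a \<Rightarrow> int"
  assumes "finite S" "f ` S \<subseteq> carrier (integer_mod_group n)" "0 < n"
  shows "finprod (integer_mod_group n) f S = (\<Sum>x\<in>S. f x) mod int n"
proof -
  interpret comm_group "integer_mod_group n" by (rule abelian_integer_mod_group)
  show ?thesis
    using assms(1,2)
  proof (induction S)
    case (insert x S)
    then have "finprod (integer_mod_group n) f (insert x S) =
        f x \<otimes>\<^bsub>integer_mod_group n\<^esub> finprod (integer_mod_group n) f S"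
      by (intro finprod_insert) auto
    then show ?case using insert assms(3) by (simp add: mod_simps)
  qed simp
qed

lemma card_restricted_sumset_less:
  fixes A :: "int set"
  assumes A: "A \<subseteq> carrier (integer_mod_group n)" "finite A"
    and h: "0 < h" "h \<le> card A"
    and n: "n = card A choose h"
    and "odd (card A)" "even n"
  shows "card (restricted_sumset (integer_mod_group n) h A) < n"
proof (rule ccontr)
  let ?R = "restricted_sumset (integer_mod_group n) h A"
  let ?\<S> = "{S. S \<subseteq> A \<and> card S = h}"
  let ?f = "\<lambda>S. \<Sum>S mod int n"
  assume "\<not> card ?R < n"
  then have ge: "n \<le> card ?R" by simp
  have npos: "0 < n" using n h(2) by (simp add: zero_less_binomial_iff)
  have fin: "finite ?\<S>" using A(2) by simp
  have "finprod (integer_mod_group n) (\<lambda>a. a) S = ?f S" if "S \<subseteq> A" for S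
    using finprod_integer_mod_group[of S "\<lambda>a. a" n] that A npos finite_subset by auto
  then have R: "?R = ?f ` ?\<S>"
    using restricted_sumset_eq_subset_sums[OF abelian_integer_mod_group A(2,1)]
    by (auto simp: image_iff) metis+
  \<comment> \<open>There are \<open>n\<close> subsets and at least \<open>n\<close> sums, so no two
    subsets share a sum, and the sums fill all residues.\<close>
  have "card ?\<S> = n" using A(2) n by (simp add: n_subsets)
  then have inj: "inj_on ?f ?\<S>"
    using ge R card_image_le[OF fin, of ?f] fin by (intro eq_card_imp_inj_on) auto
  have "?f ` ?\<S> \<subseteq> {0..<int n}" using npos by auto
  then have surj: "?f ` ?\<S> = {0..<int n}"
    using ge R by (intro card_seteq) auto
  have "(\<Sum>S\<in>?\<S>. ?f S) = \<Sum>{0..<int n}"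
    using sum.reindex[OF inj, of "\<lambda>x. x"] surj by simp
  also have "{0..<int n} = int ` {0..<n}"
    by (simp add: image_int_atLeastLessThan)
  also have "\<Sum>(int ` {0..<n}) = int (\<Sum>{0..<n})"
    by (simp add: sum.reindex)
  finally have total: "(\<Sum>S\<in>?\<S>. ?f S) = int (\<Sum>{0..<n})" .
  have "int (\<Sum>{0..<n}) mod int n = (\<Sum>S\<in>?\<S>. \<Sum>S) mod int n"
    unfolding total[symmetric] by (rule mod_sum_eq)
  also have "\<dots> = int ((card A - 1) choose (h - 1)) * \<Sum>A mod int n"
    using sum_subset_sums[OF A(2) h(1)] by simp
  \<comment> \<open>The factor \<open>card A\<close> turns the binomial coefficient on the right
    into \<open>h * n\<close>, which vanishes modulo \<open>n\<close>.\<close>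
  finally have "int (card A) * int (\<Sum>{0..<n}) mod int n
      = int (card A) * (int ((card A - 1) choose (h - 1)) * \<Sum>A) mod int n"
    by (metis mod_mult_right_eq)
  also have "int (card A) * (int ((card A - 1) choose (h - 1)) * \<Sum>A) = int (h * n) * \<Sum>A"
    using times_binomial_minus1_eq[OF h(1), of "card A"] n by (simp flip: of_nat_mult mult.assoc)
  also have "\<dots> mod int n = 0" by simp
  finally have "int n dvd int (card A * \<Sum>{0..<n})" by auto
  then have "n dvd card A * \<Sum>{0..<n}" by presburger
  \<comment> \<open>Doubling replaces the sum of all residues by \<open>n * (n - 1)\<close> without
    a division; \<open>n\<close> then cancels and a parity statement remains.\<close>
  then have "n * 2 dvd (card A * \<Sum>{0..<n}) * 2" by (rule mult_dvd_mono) simp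
  also have "\<Sum>{0..<n} * 2 = n * (n - 1)"
    using Sum_Ico_nat[of 0 n] assms(7) by simp
  then have "(card A * \<Sum>{0..<n}) * 2 = n * (card A * (n - 1))"
    by (simp only: ac_simps)
  finally have "even (card A * (n - 1))" using npos by simp
  then show False using assms(6,7) npos by auto
qed

lemma nu_restricted_cyclic_less:
  assumes "odd m" "0 < h" "h < m" "n = m choose h" "even n"
  shows "nu_restricted (integer_mod_group n) m h < n"
proof -
  let ?N = "{card (restricted_sumset (integer_mod_group n) h A) | A.
              A \<subseteq> carrier (integer_mod_group n) \<and> finite A \<and> card A = m}"
  have less: "x < n" if "x \<in> ?N" for x
    using that assms card_restricted_sumset_less by auto
  then have "?N \<subseteq> {..<n}" by blast
  then have "finite ?N" by (rule finite_subset) simp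
  \<comment> \<open>The first \<open>m\<close> residues witness that the set under
    \<open>Max\<close> is nonempty.\<close>
  moreover have "m \<le> n" using le_choose assms by simp
  then have "{0..<int m} \<subseteq> carrier (integer_mod_group n)" using assms
    by (auto simp: carrier_integer_mod_group)
  then have "card (restricted_sumset (integer_mod_group n) h {0..<int m}) \<in> ?N" by force
  then have "?N \<noteq> {}" by blast
  ultimately show ?thesis
    unfolding nu_restricted_def using less by (subst Max_less_iff) blast+
qed

theorem theorem1p6:
  fixes k h m n :: nat
  assumes "k > 0" and "h \<ge> 2"
    and "m = 2 ^ (nat \<lfloor>log 2 (real h)\<rfloor> + 1) * k + 1"
    and "n = m choose h"
  shows "nu_restricted (integer_mod_group n) m h < min n (m choose h) \<and>
         nu_restricted (integer_mod_group n) m (m - h) < min n (m choose (m - h))"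
proof -
  define s where "s = nat \<lfloor>log 2 (real h)\<rfloor> + 1"
  have m: "m = Suc (2 ^ s * k)" using assms(3) s_def by simp
  have "log 2 (real h) < real s" unfolding s_def by linarith
  then have "real h < 2 powr real s" using assms(2) by (simp add: log_less_iff)
  then have "real h < real (2 ^ s)" by (simp add: powr_realpow)
  then have "h < 2 ^ s" by (simp only: of_nat_less_iff)
  moreover have "(2::nat) ^ s \<le> 2 ^ s * k" using assms(1) by simp
  ultimately have h: "h < 2 ^ s" "h < m" using m by linarith+
  obtain j where j: "h = Suc j" "0 < j" using assms(2) by (cases h) auto
  \<comment> \<open>By Pascal's rule these two coefficients add up to \<open>n\<close>. Both lower
    indices lie strictly between 0 and \<open>2 ^ s\<close>; for \<open>j = h - 1\<close> this uses
    \<open>h \<ge> 2\<close>.\<close>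
  have "even (2 ^ s * k choose j)" "even (2 ^ s * k choose h)"
    using h(1) j by (auto intro!: even_choose_of_pow2_dvd[of s])
  then have "even n" using assms(4) m j by simp
  have "odd m" using m s_def by simp
  \<comment> \<open>Although \<open>m - h\<close> may exceed \<open>2 ^ s\<close>, symmetry gives
    the same \<open>n\<close>, whose parity is already known.\<close>
  have sym: "n = m choose (m - h)" using assms(4) h(2) binomial_symmetric[of h m] by simp
  have "nu_restricted (integer_mod_group n) m h < n"
    using nu_restricted_cyclic_less \<open>odd m\<close> \<open>even n\<close> assms(2,4) h(2) by simp
  moreover have "nu_restricted (integer_mod_group n) m (m - h) < n"
    using nu_restricted_cyclic_less[OF \<open>odd m\<close> _ _ sym \<open>even n\<close>] assms(2) h(2) by simp
  ultimately show ?thesis by (simp flip: assms(4) sym)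
qed

end
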